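(* Let $T,n\in\mathbb{N}$. Let $p_1,\dots,p_T\ge0$ with $\sum_{t=1}^Tp_t=1$, and let $Z$ be a random variable with $Z=t$ with probability $p_t$ for all $t\in[T]$. Let $Z_1,\dots,Z_n$ be independent copies of $Z$ and let $Y=\{Z_1,\dots,Z_n\}$. Let $X=(X_1,\dots,X_T)$ be an $\mathbb{R}_+^T$-valued random variable independent of $(Z_1,\dots,Z_n)$. Then, for all $\gamma>0$, $$P\left(\min_{t\in Y}X_t>e\gamma\right)\le\exp(-n)+P\left(\sum_{t=1}^Tp_tX_t>\gamma\right).$$
   Context: $[T]=\{1,\dots,T\}$, $\mathbb{R}_+=[0,\infty)$, $e$ is Euler's number. *)

theory Defs
  imports "HOL-Probability.Probability"
begin

text \<open>
  The library's \<open>indep_var\<close> requires both random variables to have the same result type.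
  The following is its version for result types that may differ.
\<close>

definition (in prob_space) indep_rvs ::
  "'b measure \<Rightarrow> ('a \<Rightarrow> 'b) \<Rightarrow> 'c measure \<Rightarrow> ('a \<Rightarrow> 'c) \<Rightarrow> bool" where
  "indep_rvs S X S' X' \<longleftrightarrow>
     random_variable S X \<and> random_variable S' X' \<and>
     indep_set {X -` A \<inter> space M | A. A \<in> sets S} {X' -` A \<inter> space M | A. A \<in> sets S'}"

lemma (in prob_space) indep_rvs_iff_indep_var: "indep_rvs S X S' X' \<longleftrightarrow> indep_var S X S' X'"
  unfolding indep_rvs_def indep_var_def indep_vars_def2 indep_set_def UNIV_bool
proof -
  have "case_bool {X -` A \<inter> space M | A. A \<in> sets S} {X' -` A \<inter> space M | A. A \<in> sets S'} =
    (\<lambda>i. {case_bool X X' i -` A \<inter> space M | A. A \<in> sets (case_bool S S' i)})"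
    by (rule ext) (simp split: bool.split)
  then show "random_variable S X \<and> random_variable S' X' \<and>
      indep_sets (case_bool {X -` A \<inter> space M | A. A \<in> sets S} {X' -` A \<inter> space M | A. A \<in> sets S'})
        {False, True} \<longleftrightarrow>
    (\<forall>i\<in>{False, True}. random_variable (case_bool S S' i) (case_bool X X' i)) \<and>
      indep_sets (\<lambda>i. {case_bool X X' i -` A \<inter> space M | A. A \<in> sets (case_bool S S' i)}) {False, True}"
    by auto
qed

end

theory Submission
  imports Defs
begin

text \<open>
  If the values \<open>X t = x t\<close> are fixed and their \<open>p\<close>-weighted mean is at most \<open>\<gamma>\<close>, then Markov's
  inequality (\<open>weight_above_level_le\<close>) bounds the \<open>p\<close>-mass of the set \<open>S = {t. x t > e * \<gamma>}\<close> of
  large indices by \<open>1 / e\<close>. The minimum of \<open>x\<close> over the sample exceeds \<open>e * \<gamma>\<close> only if all \<open>n\<close>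
  independent draws fall into \<open>S\<close>, which has probability at most \<open>(1 / e) ^ n = exp (- n)\<close>
  (\<open>prob_iid_all_in\<close>).

  For random \<open>X\<close> one has to condition on \<open>X\<close>. The sample interacts with \<open>X\<close> only through the
  random set \<open>S\<close>, which takes finitely many values. Conditioning is therefore
  a finite case distinction: the event splits according to the value of \<open>S\<close>, and for each fixed
  value the condition on \<open>X\<close> is independent of the condition on the sample
  (\<open>prob_UN_indep_le\<close>). The outcomes for which the weighted mean exceeds \<open>\<gamma>\<close> are put into the
  second summand of the bound.
\<close>

text \<open>This is Markov's inequality for the finite measure on \<open>I\<close> with point masses \<open>p t\<close>.\<close>

lemma weight_above_level_le:
  fixes p x :: "'i \<Rightarrow> real"
  assumes "finite I" and "\<And>t. t \<in> I \<Longrightarrow> p t \<ge> 0" and "\<And>t. t \<in> I \<Longrightarrow> x t \<ge> 0" and "c > 0"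
  shows "(\<Sum>t | t \<in> I \<and> x t > c. p t) \<le> (\<Sum>t\<in>I. p t * x t) / c"
proof -
  have "(\<Sum>t | t \<in> I \<and> x t > c. p t) * c = (\<Sum>t | t \<in> I \<and> x t > c. p t * c)"
    by (rule sum_distrib_right)
  also have "\<dots> \<le> (\<Sum>t | t \<in> I \<and> x t > c. p t * x t)"
    using assms by (intro sum_mono mult_left_mono) auto
  also have "\<dots> \<le> (\<Sum>t\<in>I. p t * x t)"
    using assms by (intro sum_mono2) auto
  finally show ?thesis
    using \<open>c > 0\<close> by (simp add: pos_le_divide_eq)
qed

context prob_space
begin

lemma prob_in_finite_eq_sum:
  assumes "Z \<in> M \<rightarrow>\<^sub>M count_space K" and "S \<subseteq> K" and "finite S"
  shows "\<P>(\<omega> in M. Z \<omega> \<in> S) = (\<Sum>t\<in>S. \<P>(\<omega> in M. Z \<omega> = t))"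
proof -
  have ev: "{\<omega> \<in> space M. Z \<omega> = t} \<in> events" if "t \<in> S" for t
  proof -
    have "Z -` {t} \<inter> space M \<in> events"
      using that \<open>S \<subseteq> K\<close> by (intro measurable_sets[OF assms(1)]) auto
    also have "Z -` {t} \<inter> space M = {\<omega> \<in> space M. Z \<omega> = t}"
      by auto
    finally show ?thesis .
  qed
  have "{\<omega> \<in> space M. Z \<omega> \<in> S} = (\<Union>t\<in>S. {\<omega> \<in> space M. Z \<omega> = t})"
    by auto
  then show ?thesis
    using ev \<open>finite S\<close>
    by (auto intro!: finite_measure_finite_Union simp: disjoint_family_on_def)
qed

lemma prob_iid_all_in:
  assumes "indep_vars (\<lambda>_. N) Z I" and "I \<noteq> {}" and "finite I" and "S \<in> sets N"
    and "\<And>i. i \<in> I \<Longrightarrow> \<P>(\<omega> in M. Z i \<omega> \<in> S) = q"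
  shows "\<P>(\<omega> in M. \<forall>i\<in>I. Z i \<omega> \<in> S) = q ^ card I"
proof -
  have "{\<omega> \<in> space M. \<forall>i\<in>I. Z i \<omega> \<in> S} = (\<Inter>i\<in>I. Z i -` S \<inter> space M)"
    using \<open>I \<noteq> {}\<close> by auto
  moreover have "prob (\<Inter>i\<in>I. Z i -` S \<inter> space M) = (\<Prod>i\<in>I. prob (Z i -` S \<inter> space M))"
    using assms by (intro indep_varsD) auto
  moreover have "Z i -` S \<inter> space M = {\<omega> \<in> space M. Z i \<omega> \<in> S}" for i
    by auto
  ultimately show ?thesis
    using assms(5) by simp
qed

text \<open>
  This is the law of total probability with a uniform bound on the conditional probabilities: the
  events \<open>A d\<close> are the possible values of the conditioning variable, and \<open>B d\<close>, being independent
  of \<open>A d\<close>, has conditional probability \<open>prob (B d) \<le> q\<close>.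
\<close>

lemma prob_UN_indep_le:
  assumes "finite D" and "disjoint_family_on A D" and "\<And>d. d \<in> D \<Longrightarrow> A d \<in> events"
    and "\<And>d. d \<in> D \<Longrightarrow> B d \<in> events"
    and indep: "\<And>d. d \<in> D \<Longrightarrow> prob (A d \<inter> B d) = prob (A d) * prob (B d)"
    and "\<And>d. d \<in> D \<Longrightarrow> prob (B d) \<le> q" and "q \<ge> 0"
  shows "prob (\<Union>d\<in>D. A d \<inter> B d) \<le> q"
proof -
  have "prob (\<Union>d\<in>D. A d \<inter> B d) \<le> (\<Sum>d\<in>D. prob (A d \<inter> B d))"
    using assms by (intro measure_UNION_le) auto
  also have "\<dots> \<le> (\<Sum>d\<in>D. prob (A d) * q)"
    using assms by (intro sum_mono) (simp add: mult_left_mono)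
  also have "\<dots> = prob (\<Union>d\<in>D. A d) * q"
    using assms by (subst finite_measure_finite_Union) (auto simp: sum_distrib_right)
  also have "\<dots> \<le> q"
    using \<open>q \<ge> 0\<close> by (simp add: mult_left_le_one_le)
  finally show ?thesis .
qed

lemma prob_indep_rvs:
  assumes "indep_rvs N U K V" and "A \<in> sets N" and "B \<in> sets K"
  shows "prob ((U -` A \<inter> space M) \<inter> (V -` B \<inter> space M))
    = prob (U -` A \<inter> space M) * prob (V -` B \<inter> space M)"
  using assms unfolding indep_rvs_def by (intro indep_setD) auto

end

theorem theorem19:
  fixes M :: "'a measure" and N :: "'b measure"
    and T n :: nat and p :: "nat \<Rightarrow> real"
    and Z :: "'b \<Rightarrow> nat" and Zs :: "nat \<Rightarrow> 'a \<Rightarrow> nat"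
    and Y :: "'a \<Rightarrow> nat set" and X :: "nat \<Rightarrow> 'a \<Rightarrow> real" and \<gamma> :: real
  assumes "T \<ge> 1" and "n \<ge> 1"
    and "prob_space M" and "prob_space N"
    and "\<And>t. t \<in> {1..T} \<Longrightarrow> p t \<ge> 0" and "(\<Sum>t=1..T. p t) = 1"
    and "Z \<in> N \<rightarrow>\<^sub>M count_space {1..T}"
    and "\<And>t. t \<in> {1..T} \<Longrightarrow> \<P>(\<omega> in N. Z \<omega> = t) = p t"
    and "\<And>i. i \<in> {1..n} \<Longrightarrow> Zs i \<in> M \<rightarrow>\<^sub>M count_space {1..T}"
    and "\<And>i. i \<in> {1..n} \<Longrightarrow>
           distr M (count_space {1..T}) (Zs i) = distr N (count_space {1..T}) Z"
    and "prob_space.indep_vars M (\<lambda>_. count_space {1..T}) Zs {1..n}"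
    and "\<And>\<omega>. \<omega> \<in> space M \<Longrightarrow> Y \<omega> = (\<lambda>i. Zs i \<omega>) ` {1..n}"
    and "\<And>t. t \<in> {1..T} \<Longrightarrow> X t \<in> borel_measurable M"
    and "\<And>t \<omega>. t \<in> {1..T} \<Longrightarrow> \<omega> \<in> space M \<Longrightarrow> X t \<omega> \<ge> 0"
    and "prob_space.indep_rvs M
           (\<Pi>\<^sub>M t\<in>{1..T}. borel) (\<lambda>\<omega>. \<lambda>t\<in>{1..T}. X t \<omega>)
           (\<Pi>\<^sub>M i\<in>{1..n}. count_space {1..T}) (\<lambda>\<omega>. \<lambda>i\<in>{1..n}. Zs i \<omega>)"
    and "\<gamma> > 0"
  shows "\<P>(\<omega> in M. (MIN t\<in>Y \<omega>. X t \<omega>) > exp 1 * \<gamma>)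
           \<le> exp (- real n) + \<P>(\<omega> in M. (\<Sum>t=1..T. p t * X t \<omega>) > \<gamma>)"
proof -
  interpret prob_space M by fact
  define c where "c = exp 1 * \<gamma>"
  have "c > 0" using \<open>\<gamma> > 0\<close> by (simp add: c_def)
  let ?U = "\<lambda>\<omega>. \<lambda>t\<in>{1..T}. X t \<omega>" and ?V = "\<lambda>\<omega>. \<lambda>i\<in>{1..n}. Zs i \<omega>"
  let ?PU = "\<Pi>\<^sub>M t\<in>{1..T}. (borel :: real measure)"
  let ?PV = "\<Pi>\<^sub>M i\<in>{1..n}. count_space {1..T}"
  have Z_in: "Zs i \<omega> \<in> {1..T}" if "i \<in> {1..n}" "\<omega> \<in> space M" for i \<omega>
    using measurable_space[OF assms(9)[OF that(1)] that(2)] by simp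

  \<comment> \<open>Whenever the weighted mean is at most \<open>\<gamma>\<close>, the set of large indices lies in \<open>D\<close>.\<close>
  define D where "D = {S. S \<subseteq> {1..T} \<and> (\<Sum>t\<in>S. p t) \<le> exp (- 1)}"
  define A where "A S = {\<omega> \<in> space M. {t \<in> {1..T}. X t \<omega> > c} = S}" for S
  define B where "B S = {\<omega> \<in> space M. \<forall>i\<in>{1..n}. Zs i \<omega> \<in> S}" for S
  define F where "F = {\<omega> \<in> space M. (\<Sum>t=1..T. p t * X t \<omega>) > \<gamma>}"

  have "finite D"
    by (rule finite_subset[of _ "Pow {1..T}"]) (auto simp: D_def)
  have F_event: "F \<in> events"
    unfolding F_def using assms(13) by measurable

  have A_eq: "A S = ?U -` {x \<in> space ?PU. \<forall>t\<in>{1..T}. x t > c \<longleftrightarrow> t \<in> S} \<inter> space M"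
    if "S \<in> D" for S
    using that by (auto simp: A_def D_def space_PiM)
  have A_sets: "{x \<in> space ?PU. \<forall>t\<in>{1..T}. x t > c \<longleftrightarrow> t \<in> S} \<in> sets ?PU" for S
    by measurable
  have B_eq: "B S = ?V -` (\<Pi>\<^sub>E i\<in>{1..n}. S) \<inter> space M" for S
    by (auto simp: B_def PiE_iff)
  have B_sets: "(\<Pi>\<^sub>E i\<in>{1..n}. S) \<in> sets ?PV" if "S \<in> D" for S
    using that by (intro sets_PiM_I_finite) (auto simp: D_def)
  have UV_meas: "?U \<in> M \<rightarrow>\<^sub>M ?PU" "?V \<in> M \<rightarrow>\<^sub>M ?PV"
    using assms(15) by (auto simp: indep_rvs_def)
  have A_event: "A S \<in> events" if "S \<in> D" for S
    unfolding A_eq[OF that] using UV_meas(1) A_sets by (rule measurable_sets)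
  have B_event: "B S \<in> events" if "S \<in> D" for S
    unfolding B_eq using UV_meas(2) B_sets[OF that] by (rule measurable_sets)
  have AB_event: "(\<Union>S\<in>D. A S \<inter> B S) \<in> events"
    using A_event B_event \<open>finite D\<close> by (intro sets.finite_UN sets.Int) auto
  have indep: "prob (A S \<inter> B S) = prob (A S) * prob (B S)" if "S \<in> D" for S
    unfolding A_eq[OF that] B_eq
    using assms(15) A_sets B_sets[OF that] by (rule prob_indep_rvs)

  have Z_prob: "\<P>(\<omega> in M. Zs i \<omega> = t) = p t" if i: "i \<in> {1..n}" and t: "t \<in> {1..T}" for i t
  proof -
    have "\<P>(\<omega> in M. Zs i \<omega> = t) = measure (distr M (count_space {1..T}) (Zs i)) {t}"
      using t by (subst measure_distr[OF assms(9)[OF i]]) (auto intro!: arg_cong[where f = prob])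
    also have "\<dots> = measure (distr N (count_space {1..T}) Z) {t}"
      by (simp only: assms(10)[OF i])
    also have "\<dots> = \<P>(\<omega> in N. Z \<omega> = t)"
      using t by (subst measure_distr[OF assms(7)]) (auto intro!: arg_cong[where f = "measure N"])
    finally show ?thesis
      using assms(8)[OF t] by simp
  qed
  have B_prob: "prob (B S) \<le> exp (- real n)" if "S \<in> D" for S
  proof -
    have S: "S \<subseteq> {1..T}" "(\<Sum>t\<in>S. p t) \<le> exp (- 1)"
      using that by (auto simp: D_def)
    have "\<P>(\<omega> in M. Zs i \<omega> \<in> S) = (\<Sum>t\<in>S. p t)" if "i \<in> {1..n}" for i
      using prob_in_finite_eq_sum[OF assms(9)[OF that] S(1)] finite_subset[OF S(1)] S(1)
        Z_prob[OF that] by (auto intro!: sum.cong)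
    then have "prob (B S) = (\<Sum>t\<in>S. p t) ^ card {1..n}"
      unfolding B_def using assms(11) \<open>n \<ge> 1\<close> S(1) by (intro prob_iid_all_in) auto
    also have "\<dots> \<le> exp (- 1) ^ n"
      using S assms(5) by (auto intro!: power_mono sum_nonneg)
    also have "\<dots> = exp (- real n)"
      by (simp flip: exp_of_nat_mult)
    finally show ?thesis .
  qed

  have min_iff: "(MIN t\<in>Y \<omega>. X t \<omega>) > c \<longleftrightarrow> (\<forall>i\<in>{1..n}. X (Zs i \<omega>) \<omega> > c)"
    if "\<omega> \<in> space M" for \<omega>
    using assms(12)[OF that] \<open>n \<ge> 1\<close> by (subst Min_gr_iff) auto
  have "{\<omega> \<in> space M. (MIN t\<in>Y \<omega>. X t \<omega>) > c} \<subseteq> F \<union> (\<Union>S\<in>D. A S \<inter> B S)"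
  proof
    fix \<omega> assume "\<omega> \<in> {\<omega> \<in> space M. (MIN t\<in>Y \<omega>. X t \<omega>) > c}"
    then have \<omega>: "\<omega> \<in> space M" "\<forall>i\<in>{1..n}. X (Zs i \<omega>) \<omega> > c"
      using min_iff by auto
    define S where "S = {t \<in> {1..T}. X t \<omega> > c}"
    have "S \<in> D" if "\<omega> \<notin> F"
    proof -
      have "(\<Sum>t\<in>S. p t) \<le> (\<Sum>t=1..T. p t * X t \<omega>) / c"
        unfolding S_def using assms(5,14) \<omega>(1) \<open>c > 0\<close> by (intro weight_above_level_le) auto
      also have "\<dots> \<le> \<gamma> / c"
        using that \<omega>(1) \<open>c > 0\<close> by (intro divide_right_mono) (auto simp: F_def)
      also have "\<dots> = exp (- 1)"
        using \<open>\<gamma> > 0\<close> by (simp add: c_def exp_minus field_simps)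
      finally show ?thesis
        by (auto simp: D_def S_def)
    qed
    moreover have "\<omega> \<in> A S \<inter> B S"
      using \<omega> Z_in by (auto simp: A_def B_def S_def)
    ultimately show "\<omega> \<in> F \<union> (\<Union>S\<in>D. A S \<inter> B S)"
      by blast
  qed
  then have "\<P>(\<omega> in M. (MIN t\<in>Y \<omega>. X t \<omega>) > c) \<le> prob (F \<union> (\<Union>S\<in>D. A S \<inter> B S))"
    using F_event AB_event by (intro finite_measure_mono) auto
  also have "\<dots> \<le> prob F + prob (\<Union>S\<in>D. A S \<inter> B S)"
    using F_event AB_event by (intro measure_Un_le) auto
  also have "prob (\<Union>S\<in>D. A S \<inter> B S) \<le> exp (- real n)"
  proof (rule prob_UN_indep_le)
    show "disjoint_family_on A D"
      by (auto simp: disjoint_family_on_def A_def)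
  qed (use \<open>finite D\<close> A_event B_event indep B_prob in auto)
  finally show ?thesis
    by (simp add: c_def F_def)
qed

end
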